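(* Suppose the metric space $X$ contains a point $x_0$ with the property that for every $\varepsilon>0$ there is a $\delta>0$ such that for every continuous function $f\colon B^2\to X$ with $f(S^1)\subset B(x_0,\delta)$, there is a continuous function $g\colon B^2\to X$ such that $g|_{S^1}=f|_{S^1}$ and $g(B^2)\subset B(x_0,\varepsilon)$. Then $X$ is homotopically Hausdorff at $x_0$.
   Context: $B^2$ is the closed unit disc with boundary $S^1$, and $B(x_0,\rho)$ is the ball of radius $\rho$ about $x_0$ in $X$. A loop is nulhomotopic (inessential) if it extends, as a map from $S^1$, to a continuous map from $B^2$; otherwise it is essential. A space $X$ is homotopically Hausdorff at $x_0\in X$ if for every essential loop $\gamma$ based at $x_0$ there is a neighborhood $U$ of $x_0$ such that no loop in $U$ is homotopic in $X$ to $\gamma$ rel $x_0$. *)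

theory Defs
  imports "HOL-Analysis.Analysis"
begin

text \<open>
  A space is a subset \<open>X\<close> of a topological (or metric) type, carrying the subspace structure;
  \<open>X = UNIV\<close> gives the whole type. The closed disc and the circle are \<open>cball 0 1\<close> and
  \<open>sphere 0 1\<close> in \<open>complex\<close>.
\<close>

definition loop_at :: "'a::topological_space set \<Rightarrow> 'a \<Rightarrow> (real \<Rightarrow> 'a) \<Rightarrow> bool" where
  "loop_at S x p \<longleftrightarrow> path p \<and> path_image p \<subseteq> S \<and> pathstart p = x \<and> pathfinish p = x"

text \<open>
  A loop, parametrised over \<open>[0, 1]\<close>, is regarded as a map from the circle through
  \<open>t \<mapsto> cis (2 * pi * t)\<close>.
\<close>

definition nulhomotopic_loop :: "'a::topological_space set \<Rightarrow> (real \<Rightarrow> 'a) \<Rightarrow> bool" where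
  "nulhomotopic_loop X p \<longleftrightarrow>
     (\<exists>F :: complex \<Rightarrow> 'a. continuous_on (cball 0 1) F \<and> F ` cball 0 1 \<subseteq> X \<and>
        (\<forall>t\<in>{0..1}. F (cis (2 * pi * t)) = p t))"

abbreviation essential_loop :: "'a::topological_space set \<Rightarrow> (real \<Rightarrow> 'a) \<Rightarrow> bool" where
  "essential_loop X p \<equiv> \<not> nulhomotopic_loop X p"

text \<open>
  \<^const>\<open>homotopic_paths\<close> fixes both endpoints throughout the homotopy, so for loops based at
  \<open>x\<close> it is homotopy rel \<open>x\<close>.
\<close>

definition homotopically_hausdorff_at :: "'a::topological_space set \<Rightarrow> 'a \<Rightarrow> bool" where
  "homotopically_hausdorff_at X x \<longleftrightarrow>
     (\<forall>\<gamma>. loop_at X x \<gamma> \<and> essential_loop X \<gamma> \<longrightarrow>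
        (\<exists>U. openin (top_of_set X) U \<and> x \<in> U \<and>
           \<not> (\<exists>p. loop_at U x p \<and> homotopic_paths X p \<gamma>)))"

end

theory Submission
  imports Defs
begin

text \<open>
  Argue by contraposition: let \<open>\<gamma>\<close> be a loop that is homotopic, rel \<open>x0\<close>, to loops inside every
  neighbourhood of \<open>x0\<close>; it has to be shown that \<open>\<gamma>\<close> bounds a disc in \<open>X\<close>. Let \<open>\<delta> n\<close> be the
  radius that the hypothesis supplies for \<open>\<epsilon> = 1 / (n + 1)\<close>, and choose loops \<open>p\<^sub>n\<close> homotopic to \<open>\<gamma>\<close>
  with \<open>p\<^sub>n\<close> in the ball of radius \<open>min (\<delta> 0) \<dots> (\<delta> n)\<close> about \<open>x0\<close>. Consecutive loops are
  homotopic to each other through \<open>\<gamma>\<close>, by a homotopy that may wander far away from \<open>x0\<close>. But the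
  homotopy is a map of a square, hence of a disc, whose boundary runs only through \<open>p\<^sub>n\<close>,
  \<open>p\<^sub>n\<^sub>+\<^sub>1\<close> and \<open>x0\<close>, that is, inside the \<open>\<delta> n\<close>-ball. The hypothesis therefore
  replaces it by a homotopy with the same boundary values that stays within \<open>1 / (n + 1)\<close> of
  \<open>x0\<close> (lemma \<open>fill_square_from_fill_disc\<close>).

  Now stack infinitely many homotopies: first any homotopy from \<open>\<gamma>\<close> to \<open>p\<^sub>0\<close>, then the small
  ones from \<open>p\<^sub>n\<close> to \<open>p\<^sub>n\<^sub>+\<^sub>1\<close>. Laid out as concentric annuli that accumulate
  at the centre of the disc, they give a map of the punctured disc into \<open>X\<close>. As the images of
  the annuli shrink to \<open>x0\<close>, the map extends continuously by \<open>x0\<close> at the centre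
  (lemma \<open>nulhomotopic_loop_if_shrinking_homotopies\<close>), so \<open>\<gamma>\<close> is nulhomotopic.
\<close>

section \<open>The disc as a quotient of the square by polar coordinates\<close>

text \<open>
  A continuous map from a compact space to a Hausdorff space is closed, hence a quotient map onto
  its image.
\<close>

lemma continuous_factor_through_compact:
  fixes p :: "'a::t2_space \<Rightarrow> 'b::t2_space" and h :: "'a \<Rightarrow> 'c::topological_space"
  assumes "compact S" "continuous_on S p" "continuous_on S h"
    and fib: "\<And>x y. x \<in> S \<Longrightarrow> y \<in> S \<Longrightarrow> p x = p y \<Longrightarrow> h x = h y"
  obtains G where "continuous_on (p ` S) G" "\<And>x. x \<in> S \<Longrightarrow> G (p x) = h x"
proof
  define G where "G y = h (inv_into S p y)" for y
  show G: "G (p x) = h x" if "x \<in> S" for x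
    unfolding G_def by (rule fib) (use that in \<open>auto simp: inv_into_into f_inv_into_f\<close>)
  have "continuous_on (p ` S) G \<longleftrightarrow>
      (\<forall>U. openin (top_of_set UNIV) U \<longrightarrow> openin (top_of_set (p ` S)) (p ` S \<inter> G -` U))"
    by (rule continuous_on_open_gen) simp
  also have "\<dots>"
  proof (intro allI impI)
    fix U assume U: "openin (top_of_set UNIV) (U :: 'c set)"
    have "S \<inter> p -` (p ` S \<inter> G -` U) = S \<inter> h -` U"
    proof -
      have "p x \<in> p ` S \<inter> G -` U \<longleftrightarrow> h x \<in> U" if "x \<in> S" for x
        using G[OF that] that by simp
      then show ?thesis by blast
    qed
    moreover have "openin (top_of_set S) (S \<inter> h -` U)"
      using assms(3) U by (simp add: continuous_openin_preimage_gen)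
    ultimately show "openin (top_of_set (p ` S)) (p ` S \<inter> G -` U)"
      using Abstract_Topology_2.continuous_imp_quotient_map[OF assms(2) refl assms(1), of "p ` S \<inter> G -` U"] by simp
  qed
  finally show "continuous_on (p ` S) G" .
qed

lemma polar_coordinates_unit_disc:
  "(\<lambda>(r, t). rcis r (2 * pi * t)) ` ({0..1} \<times> {0..1}) = cball 0 1"
proof -
  have "\<exists>r t. z = rcis r (2 * pi * t) \<and> r \<in> {0..1} \<and> t \<in> {0..1}" if "norm z \<le> 1" for z :: complex
  proof (rule exI[of _ "norm z"], rule exI[of _ "Arg2pi z / (2 * pi)"], intro conjI)
    have "Arg2pi z < 2 * pi" "0 \<le> Arg2pi z"
      using Arg2pi by auto
    then show "Arg2pi z / (2 * pi) \<in> {0..1}" by (simp add: field_simps)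
    show "z = rcis (norm z) (2 * pi * (Arg2pi z / (2 * pi)))"
      using Arg2pi_eq[of z] by (simp add: rcis_def cis_conv_exp)
  qed (use that in auto)
  then show ?thesis by (fastforce simp: image_iff)
qed

text \<open>
  These are the only identifications that polar coordinates make on the square: the edge
  \<open>r = 0\<close> collapses to the centre, and the edges \<open>t = 0\<close> and \<open>t = 1\<close> are glued along a radius.
\<close>

lemma rcis_eq_unit_interval:
  assumes "rcis r (2 * pi * t) = rcis r' (2 * pi * t')"
    and "0 \<le> r" "0 \<le> r'" "t \<in> {0..1}" "t' \<in> {0..1}"
  shows "r = r' \<and> (r = 0 \<or> t = t' \<or> {t, t'} = {0, 1})"
proof -
  have r: "r = r'"
    using arg_cong[OF assms(1), of norm] assms(2,3) by simp
  have "t = t' \<or> {t, t'} = {0, 1}" if "r \<noteq> 0"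
  proof -
    have "cis (2 * pi * t) = cis (2 * pi * t')"
      using assms(1) that r by (simp add: rcis_def)
    then have "cis (2 * pi * (t - t')) = 1"
      by (simp add: right_diff_distrib flip: cis_divide)
    then have "cos (2 * pi * (t - t')) = 1"
      by (metis cis.sel(1) one_complex.sel(1))
    then obtain n :: int where "2 * pi * (t - t') = of_int n * 2 * pi"
      unfolding cos_one_2pi_int by auto
    then have n: "t - t' = of_int n" by simp
    with assms have "\<bar>of_int n\<bar> \<le> (1::real)" by auto
    then have "n = -1 \<or> n = 0 \<or> n = 1" by linarith
    then show ?thesis using n assms by auto
  qed
  with r show ?thesis by auto
qed

lemma map_of_disc_from_polar:
  fixes H :: "real \<times> real \<Rightarrow> 'a::topological_space"
  assumes "continuous_on ({0..1} \<times> {0..1}) H"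
    and centre: "\<And>t. t \<in> {0..1} \<Longrightarrow> H (0, t) = x"
    and seam: "\<And>r. r \<in> {0..1} \<Longrightarrow> H (r, 0) = H (r, 1)"
  obtains F where "continuous_on (cball 0 1) F"
    "\<And>r t. r \<in> {0..1} \<Longrightarrow> t \<in> {0..1} \<Longrightarrow> F (rcis r (2 * pi * t)) = H (r, t)"
proof -
  let ?p = "\<lambda>(r, t). rcis r (2 * pi * t)"
  obtain F where "continuous_on (?p ` ({0..1} \<times> {0..1})) F"
    and F: "\<And>z. z \<in> {0..1} \<times> {0..1} \<Longrightarrow> F (?p z) = H z"
  proof (rule continuous_factor_through_compact[of "{0..1} \<times> {0..1}" ?p H])
    show "compact ({0..1::real} \<times> {0..1::real})"
      by (intro compact_Times compact_Icc)
    show "continuous_on ({0..1} \<times> {0..1}) ?p"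
      unfolding rcis_def case_prod_unfold cis_conv_exp by (intro continuous_intros)
    show "H z = H w" if zw: "z \<in> {0..1} \<times> {0..1}" "w \<in> {0..1} \<times> {0..1}" "?p z = ?p w" for z w
    proof -
      obtain r t r' t' where eq: "z = (r, t)" "w = (r', t')" by fastforce
      with zw have "r = r' \<and> (r = 0 \<or> t = t' \<or> {t, t'} = {0, 1})"
        by (intro rcis_eq_unit_interval) auto
      with zw seam centre show ?thesis unfolding eq doubleton_eq_iff by auto
    qed
  qed (use assms in auto)
  then show ?thesis
    using that unfolding polar_coordinates_unit_disc by fastforce
qed

section \<open>Filling squares instead of discs\<close>

text \<open>
  That the boundaries correspond is invariance of domain, applied to each of the two maps: an
  injective continuous map between spaces of the same dimension sends interior points to interior
  points.
\<close>

lemma homeomorphism_disc_square: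
  obtains f :: "complex \<Rightarrow> real \<times> real" and g
  where "homeomorphism (cball 0 1) ({0..1} \<times> {0..1}) f g"
    "f ` sphere 0 1 \<subseteq> {0..1} \<times> {0..1} - {0<..<1} \<times> {0<..<1}"
    "g ` ({0..1} \<times> {0..1} - {0<..<1} \<times> {0<..<1}) \<subseteq> sphere 0 1"
proof -
  let ?Q = "{0..1::real} \<times> {0..1::real}"
  have int: "interior ?Q = {0<..<1} \<times> {0<..<1}"
    by (simp add: interior_Times)
  have "cball (0::complex) 1 homeomorphic ?Q"
  proof (rule homeomorphic_convex_compact_sets)
    have "aff_dim ?Q = 2"
      using int by (subst aff_dim_nonempty_interior) auto
    then show "aff_dim (cball (0::complex) 1) = aff_dim ?Q"
      by (simp add: aff_dim_cball)
  qed (auto intro: convex_Times compact_Times)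
  then obtain f g where h: "homeomorphism (cball (0::complex) 1) ?Q f g"
    unfolding homeomorphic_def by auto
  have gf: "\<And>z. z \<in> cball 0 1 \<Longrightarrow> g (f z) = z" and fg: "\<And>z. z \<in> ?Q \<Longrightarrow> f (g z) = z"
    and fi: "f ` cball 0 1 = ?Q" and gi: "g ` ?Q = cball 0 1"
    and c: "continuous_on (cball 0 1) f" "continuous_on ?Q g"
    using h unfolding homeomorphism_def by auto
  have inj: "inj_on f (cball 0 1)" "inj_on g ?Q"
    using gf fg by (metis inj_on_inverseI)+
  have fint: "f ` ball 0 1 \<subseteq> interior ?Q"
    using continuous_image_subset_interior[OF c(1) inj(1)] fi by (simp add: image_subset_iff_funcset)
  have gint: "g ` interior ?Q \<subseteq> ball 0 1"
    using continuous_image_subset_interior[OF c(2) inj(2)] gi by (simp add: image_subset_iff_funcset)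
  have "f ` sphere 0 1 \<subseteq> ?Q - interior ?Q"
  proof (intro image_subsetI)
    fix z :: complex assume z: "z \<in> sphere 0 1"
    then have "z \<in> cball 0 1" by auto
    moreover have "f z \<notin> interior ?Q"
      using gint gf[OF \<open>z \<in> cball 0 1\<close>] z by force
    ultimately show "f z \<in> ?Q - interior ?Q" using fi by blast
  qed
  moreover have "g ` (?Q - interior ?Q) \<subseteq> sphere 0 1"
  proof (intro image_subsetI)
    fix z assume z: "z \<in> ?Q - interior ?Q"
    then have "g z \<in> cball 0 1" using gi by blast
    moreover have "g z \<notin> ball 0 1"
      using fint fg[of z] z by (metis DiffE image_subset_iff)
    ultimately show "g z \<in> sphere 0 1" by auto
  qed
  ultimately show ?thesis using that h int by simp
qed

text \<open>
  Homotopies of paths live on the square, while the hypothesis of the theorem speaks of the disc;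
  composition with a homeomorphism carries the filling property over. Here \<open>A\<close> stands for the
  small ball that contains the boundary values, and \<open>B\<close> for the ball that the new map has to
  stay in.
\<close>

lemma fill_square_from_fill_disc:
  fixes X A B :: "'a::topological_space set"
  assumes fill: "\<And>f :: complex \<Rightarrow> 'a.
      continuous_on (cball 0 1) f \<Longrightarrow> f ` cball 0 1 \<subseteq> X \<Longrightarrow> f ` sphere 0 1 \<subseteq> A \<Longrightarrow>
      \<exists>g. continuous_on (cball 0 1) g \<and> (\<forall>z\<in>sphere 0 1. g z = f z) \<and> g ` cball 0 1 \<subseteq> B"
    and h: "continuous_on ({0..1} \<times> {0..1}) h" "h ` ({0..1} \<times> {0..1}) \<subseteq> X"
    and bd: "h ` ({0..1} \<times> {0..1} - {0<..<1} \<times> {0<..<1}) \<subseteq> A"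
  obtains k :: "real \<times> real \<Rightarrow> 'a" where "continuous_on ({0..1} \<times> {0..1}) k"
    "k ` ({0..1} \<times> {0..1}) \<subseteq> B"
    "\<And>z. z \<in> {0..1} \<times> {0..1} - {0<..<1} \<times> {0<..<1} \<Longrightarrow> k z = h z"
proof -
  let ?Q = "{0..1::real} \<times> {0..1::real}" and ?I = "{0<..<1::real} \<times> {0<..<1::real}"
  obtain p q where pq: "homeomorphism (cball (0::complex) 1) ?Q p q"
    and p: "p ` sphere 0 1 \<subseteq> ?Q - ?I" and q: "q ` (?Q - ?I) \<subseteq> sphere 0 1"
    by (rule homeomorphism_disc_square)
  have pi: "p ` cball 0 1 = ?Q" and qi: "q ` ?Q = cball 0 1"
    and c: "continuous_on (cball 0 1) p" "continuous_on ?Q q"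
    using pq unfolding homeomorphism_def by auto
  have "continuous_on (cball 0 1) (h \<circ> p)"
    using c h pi by (intro continuous_on_compose) auto
  moreover have "(h \<circ> p) ` cball 0 1 \<subseteq> X"
    by (metis h(2) image_comp pi)
  moreover have "(h \<circ> p) ` sphere 0 1 \<subseteq> A"
    using p bd by fastforce
  ultimately obtain g where g: "continuous_on (cball 0 1) g"
    "\<And>z. z \<in> sphere 0 1 \<Longrightarrow> g z = h (p z)" "g ` cball 0 1 \<subseteq> B"
    using fill[of "h \<circ> p"] by auto
  show ?thesis
  proof
    show "continuous_on ?Q (g \<circ> q)"
      using c g qi by (intro continuous_on_compose) auto
    show "(g \<circ> q) ` ?Q \<subseteq> B"
      by (metis g(3) image_comp qi)
    show "(g \<circ> q) z = h z" if "z \<in> ?Q - ?I" for z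
    proof -
      have "q z \<in> sphere 0 1" using q that by blast
      then show ?thesis
        using g(2) homeomorphism_apply2[OF pq] that by simp
    qed
  qed
qed

section \<open>Stacking infinitely many homotopies\<close>

text \<open>
  Placing \<open>K n\<close> on \<open>{n..n + 1} \<times> {0..1}\<close> avoids all rescaling: the strips form a locally finite
  closed cover of the half-strip, and adjacent maps agree where their strips meet.
\<close>

lemma continuous_on_halfstrip_concatenation:
  fixes K :: "nat \<Rightarrow> real \<times> real \<Rightarrow> 'a::topological_space"
  assumes cont: "\<And>n. continuous_on ({0..1} \<times> {0..1}) (K n)"
    and match: "\<And>n t. t \<in> {0..1} \<Longrightarrow> K n (1, t) = K (Suc n) (0, t)"
  shows "continuous_on ({0..} \<times> {0..1}) (\<lambda>(s, t). K (nat \<lfloor>s\<rfloor>) (frac s, t))"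
proof -
  define F where "F = (\<lambda>(s::real, t). K (nat \<lfloor>s\<rfloor>) (frac s, t))"
  have F_eq: "F (s, t) = K n (s - real n, t)"
    if "s \<in> {real n..real n + 1}" "t \<in> {0..1}" for s t n
  \<comment> \<open>At the right end of the strip the definition already uses \<open>K (Suc n)\<close>; there the matching
    condition is needed.\<close>
  proof (cases "s = real n + 1")
    case True
    then have fl: "\<lfloor>s\<rfloor> = int (Suc n)" by linarith
    then have "frac s = 0" using True by (simp add: frac_def)
    with fl have "F (s, t) = K (Suc n) (0, t)" by (simp only: F_def case_prod_conv nat_int)
    moreover have "s - real n = 1" using True by simp
    ultimately show ?thesis using match[OF that(2), of n] by simp
  next
    case False
    then have fl: "\<lfloor>s\<rfloor> = int n" using that by (intro floor_unique) auto
    then show ?thesis by (simp add: F_def frac_def)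
  qed
  have piece: "continuous_on ({real n..real n + 1} \<times> {0..1}) F" for n
  proof -
    have "continuous_on ({real n..real n + 1} \<times> {0..1}) (\<lambda>z. K n (fst z - real n, snd z))"
      by (intro continuous_on_compose2[OF cont[of n]] continuous_intros) auto
    then show ?thesis
      by (rule continuous_on_eq) (auto simp: F_eq)
  qed
  have initial: "continuous_on ({0..real n} \<times> {0..1}) F" for n
  proof (induction n)
    case 0
    show ?case using piece[of 0] by (rule continuous_on_subset) auto
  next
    case (Suc n)
    have "{0..real (Suc n)} \<times> {0..1} =
        {0..real n} \<times> {0..1} \<union> {real n..real n + 1} \<times> {0..1::real}"
      by auto
    then show ?case
      using continuous_on_closed_Un[OF _ _ Suc piece[of n]] by (simp add: closed_Times)
  qed
  have "continuous (at (s, t) within {0..} \<times> {0..1}) F" if "s \<ge> 0" "t \<in> {0..1}" for s t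
  proof -
    obtain n where n: "s < real n" using reals_Archimedean2 by blast
    have "at (s, t) within {0..} \<times> {0..1} = at (s, t) within {0..real n} \<times> {0..1}"
      by (rule at_within_nhd[of _ "{..<real n} \<times> UNIV"]) (use n in \<open>auto intro: open_Times\<close>)
    then show ?thesis
      using initial[of n] n that by (simp add: continuous_on_eq_continuous_within)
  qed
  then show ?thesis
    unfolding F_def[symmetric] by (auto simp: continuous_on_eq_continuous_within)
qed

text \<open>
  The substitution \<open>s = 1 / r - 1\<close> turns the half-strip \<open>s \<ge> 0\<close> into \<open>0 < r \<le> 1\<close>, with the first
  homotopy beginning at \<open>r = 1\<close> and the end at infinity moved to \<open>r = 0\<close>. Near that edge only
  homotopies of large index occur, and their images lie close to \<open>x\<close>; this gives continuity
  there.
\<close>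

lemma infinite_concatenation_of_homotopies:
  fixes K :: "nat \<Rightarrow> real \<times> real \<Rightarrow> 'a::metric_space"
  assumes cont: "\<And>n. continuous_on ({0..1} \<times> {0..1}) (K n)"
    and match: "\<And>n t. t \<in> {0..1} \<Longrightarrow> K n (1, t) = K (Suc n) (0, t)"
    and shrink: "\<And>e. e > 0 \<Longrightarrow> \<forall>\<^sub>F n in sequentially. K n ` ({0..1} \<times> {0..1}) \<subseteq> ball x e"
  defines "H \<equiv> (\<lambda>(r, t). if r = 0 then x else K (nat \<lfloor>1 / r - 1\<rfloor>) (frac (1 / r - 1), t))"
  shows "continuous_on ({0..1} \<times> {0..1}) H"
proof -
  let ?Q = "{0..1::real} \<times> {0..1::real}"
  have frac01: "(frac s, t) \<in> ?Q" if "t \<in> {0..1}" for s t :: real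
    using that frac_lt_1[of s] by (auto simp: less_imp_le)
  have "continuous_on ({0<..1} \<times> {0..1})
      (\<lambda>z. (\<lambda>(s, t). K (nat \<lfloor>s\<rfloor>) (frac s, t)) (1 / fst z - 1, snd z))"
    by (intro continuous_on_compose2[OF continuous_on_halfstrip_concatenation[of K, OF cont match]]
        continuous_intros) auto
  then have away: "continuous_on ({0<..1} \<times> {0..1}) H"
    by (rule continuous_on_eq) (auto simp: H_def)
  have "continuous (at (r, t) within ?Q) H" if rt: "r \<in> {0..1}" "t \<in> {0..1}" for r t
  proof (cases "r = 0")
    case False
    have "at (r, t) within ?Q = at (r, t) within {0<..1} \<times> {0..1}"
      by (rule at_within_nhd[of _ "{0<..} \<times> UNIV"]) (use False rt in \<open>auto intro: open_Times\<close>)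
    then show ?thesis
      using away False rt by (simp add: continuous_on_eq_continuous_within)
  next
    case True
    show ?thesis
      unfolding continuous_within_eps_delta
    proof (intro allI impI)
      fix e :: real assume "e > 0"
      then obtain N where N: "\<And>n. n \<ge> N \<Longrightarrow> K n ` ?Q \<subseteq> ball x e"
        using shrink unfolding eventually_sequentially by blast
      have "dist (H z) (H (r, t)) < e" if z: "z \<in> ?Q" "dist z (r, t) < 1 / (real N + 1)" for z
      proof -
        obtain r' t' where zeq: "z = (r', t')" by fastforce
        have "r' < 1 / (real N + 1)"
          using z(2) dist_fst_le[of z "(r, t)"] True by (simp add: zeq dist_real_def)
        moreover have "K (nat \<lfloor>1 / r' - 1\<rfloor>) (frac (1 / r' - 1), t') \<in> ball x e"
          if "r' < 1 / (real N + 1)" "r' \<noteq> 0"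
        proof -
          have "real N \<le> 1 / r' - 1"
            using that z(1) zeq by (simp add: field_simps)
          then have "N \<le> nat \<lfloor>1 / r' - 1\<rfloor>" by linarith
          then show ?thesis
            using N frac01[of t' "1 / r' - 1"] z(1) zeq by blast
        qed
        ultimately show ?thesis
          using \<open>e > 0\<close> True by (auto simp: H_def zeq dist_commute)
      qed
      then show "\<exists>d>0. \<forall>z\<in>?Q. dist z (r, t) < d \<longrightarrow> dist (H z) (H (r, t)) < e"
        by (intro exI[of _ "1 / (real N + 1)"]) auto
    qed
  qed
  then show ?thesis
    by (auto simp: continuous_on_eq_continuous_within)
qed

text \<open>
  With \<open>r\<close> read as a radius and \<open>t\<close> as an angle, the concatenation is compatible with the
  identifications of polar coordinates: it is constant on \<open>r = 0\<close>, and all stages of the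
  homotopies are loops based at \<open>x\<close>. The outer circle \<open>r = 1\<close> carries the initial loop.
\<close>

lemma nulhomotopic_loop_if_shrinking_homotopies:
  fixes K :: "nat \<Rightarrow> real \<times> real \<Rightarrow> 'a::metric_space"
  assumes "x \<in> X"
    and cont: "\<And>n. continuous_on ({0..1} \<times> {0..1}) (K n)"
    and sub: "\<And>n. K n ` ({0..1} \<times> {0..1}) \<subseteq> X"
    and match: "\<And>n t. t \<in> {0..1} \<Longrightarrow> K n (1, t) = K (Suc n) (0, t)"
    and based: "\<And>n s. s \<in> {0..1} \<Longrightarrow> K n (s, 0) = x \<and> K n (s, 1) = x"
    and shrink: "\<And>e. e > 0 \<Longrightarrow> \<forall>\<^sub>F n in sequentially. K n ` ({0..1} \<times> {0..1}) \<subseteq> ball x e"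
    and start: "\<And>t. t \<in> {0..1} \<Longrightarrow> K 0 (0, t) = p t"
  shows "nulhomotopic_loop X p"
proof -
  let ?Q = "{0..1::real} \<times> {0..1::real}"
  define H where
    "H = (\<lambda>(r, t). if r = 0 then x else K (nat \<lfloor>1 / r - 1\<rfloor>) (frac (1 / r - 1), t))"
  have frac01: "frac s \<in> {0..1}" for s :: real
    using frac_lt_1[of s] by (auto simp: less_imp_le)
  have "continuous_on ?Q H"
    unfolding H_def by (rule infinite_concatenation_of_homotopies[OF cont match shrink])
  then obtain F where F: "continuous_on (cball 0 1) F"
    "\<And>r t. r \<in> {0..1} \<Longrightarrow> t \<in> {0..1} \<Longrightarrow> F (rcis r (2 * pi * t)) = H (r, t)"
  proof (rule map_of_disc_from_polar)
    show "H (0, t) = x" for t by (simp add: H_def)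
    show "H (r, 0) = H (r, 1)" for r
      using based[OF frac01] by (simp add: H_def)
  qed blast
  have "H z \<in> X" if z: "z \<in> ?Q" for z
  proof -
    have "(frac (1 / fst z - 1), snd z) \<in> ?Q"
      using z frac01 by auto
    then have "K n (frac (1 / fst z - 1), snd z) \<in> X" for n
      using sub[of n] by blast
    then show ?thesis
      using assms(1) by (simp add: H_def case_prod_unfold)
  qed
  then have "F ` cball 0 1 \<subseteq> X"
    unfolding polar_coordinates_unit_disc[symmetric] using F(2) by fastforce
  moreover have "F (cis (2 * pi * t)) = p t" if "t \<in> {0..1}" for t
    using F(2)[of 1 t] start[OF that] that by (simp add: H_def rcis_def)
  ultimately show ?thesis
    unfolding nulhomotopic_loop_def using F(1) by blast
qed

section \<open>Homotopically Hausdorff points\<close>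

lemma homotopic_loops_square:
  fixes X :: "'a::topological_space set"
  assumes "homotopic_paths X p q" "pathstart p = x" "pathfinish p = x"
  obtains h :: "real \<times> real \<Rightarrow> 'a"
  where "continuous_on ({0..1} \<times> {0..1}) h" "h ` ({0..1} \<times> {0..1}) \<subseteq> X"
    "\<And>t. t \<in> {0..1} \<Longrightarrow> h (0, t) = p t" "\<And>t. t \<in> {0..1} \<Longrightarrow> h (1, t) = q t"
    "\<And>s. s \<in> {0..1} \<Longrightarrow> h (s, 0) = x \<and> h (s, 1) = x"
proof -
  obtain h :: "real \<times> real \<Rightarrow> 'a"
    where h: "continuous_on ({0..1} \<times> {0..1}) h" "h \<in> ({0..1} \<times> {0..1}) \<rightarrow> X"
    "\<forall>t\<in>{0..1}. h (0, t) = p t" "\<forall>t\<in>{0..1}. h (1, t) = q t"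
    "\<forall>s\<in>{0..1}. pathstart (h \<circ> Pair s) = pathstart p \<and> pathfinish (h \<circ> Pair s) = pathfinish p"
    using assms(1) unfolding homotopic_paths by blast
  show ?thesis
  proof (rule that[of h])
    show "h (s, 0) = x \<and> h (s, 1) = x" if "s \<in> {0..1}" for s
      using h(5) assms(2,3) that by (simp add: pathstart_def pathfinish_def)
  qed (use h in \<open>auto simp: image_subset_iff_funcset\<close>)
qed

theorem lemma4p1:
  fixes X :: "'a::metric_space set" and x0 :: 'a
  assumes "x0 \<in> X"
    and "\<And>\<epsilon>::real. \<epsilon> > 0 \<Longrightarrow> \<exists>\<delta>>0. \<forall>f :: complex \<Rightarrow> 'a.
           continuous_on (cball 0 1) f \<and> f ` cball 0 1 \<subseteq> X \<and> f ` sphere 0 1 \<subseteq> X \<inter> ball x0 \<delta> \<longrightarrow>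
           (\<exists>g :: complex \<Rightarrow> 'a. continuous_on (cball 0 1) g \<and> g ` cball 0 1 \<subseteq> X \<and>
              (\<forall>z\<in>sphere 0 1. g z = f z) \<and> g ` cball 0 1 \<subseteq> X \<inter> ball x0 \<epsilon>)"
  shows "homotopically_hausdorff_at X x0"
  unfolding homotopically_hausdorff_at_def
proof (intro allI impI, rule ccontr)
  fix \<gamma> assume \<gamma>: "loop_at X x0 \<gamma> \<and> essential_loop X \<gamma>"
  assume "\<not> (\<exists>U. openin (top_of_set X) U \<and> x0 \<in> U \<and>
      \<not> (\<exists>p. loop_at U x0 p \<and> homotopic_paths X p \<gamma>))"
  then have small: "\<exists>p. loop_at U x0 p \<and> homotopic_paths X p \<gamma>"
    if "openin (top_of_set X) U" "x0 \<in> U" for U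
    using that by blast
  let ?Q = "{0..1::real} \<times> {0..1::real}" and ?I = "{0<..<1::real} \<times> {0<..<1::real}"
  have "\<exists>\<delta>>0. \<forall>f :: complex \<Rightarrow> 'a.
      continuous_on (cball 0 1) f \<longrightarrow> f ` cball 0 1 \<subseteq> X \<longrightarrow> f ` sphere 0 1 \<subseteq> X \<inter> ball x0 \<delta> \<longrightarrow>
      (\<exists>g. continuous_on (cball 0 1) g \<and> (\<forall>z\<in>sphere 0 1. g z = f z) \<and>
         g ` cball 0 1 \<subseteq> X \<inter> ball x0 (1 / (real n + 1)))" for n
  proof -
    obtain d where "d > 0" and d: "\<forall>f :: complex \<Rightarrow> 'a.
        continuous_on (cball 0 1) f \<and> f ` cball 0 1 \<subseteq> X \<and> f ` sphere 0 1 \<subseteq> X \<inter> ball x0 d \<longrightarrow>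
        (\<exists>g :: complex \<Rightarrow> 'a. continuous_on (cball 0 1) g \<and> g ` cball 0 1 \<subseteq> X \<and>
           (\<forall>z\<in>sphere 0 1. g z = f z) \<and> g ` cball 0 1 \<subseteq> X \<inter> ball x0 (1 / (real n + 1)))"
      using assms(2)[of "1 / (real n + 1)"] by auto
    show ?thesis
    proof (intro exI[of _ d] conjI allI impI)
      fix f :: "complex \<Rightarrow> 'a"
      assume "continuous_on (cball 0 1) f" "f ` cball 0 1 \<subseteq> X" "f ` sphere 0 1 \<subseteq> X \<inter> ball x0 d"
      with d obtain g where "continuous_on (cball 0 1) g" "\<forall>z\<in>sphere 0 1. g z = f z"
        "g ` cball 0 1 \<subseteq> X \<inter> ball x0 (1 / (real n + 1))" by metis
      then show "\<exists>g. continuous_on (cball 0 1) g \<and> (\<forall>z\<in>sphere 0 1. g z = f z) \<and>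
         g ` cball 0 1 \<subseteq> X \<inter> ball x0 (1 / (real n + 1))" by blast
    qed (fact \<open>d > 0\<close>)
  qed
  then obtain \<delta> :: "nat \<Rightarrow> real" where \<delta>: "\<And>n. \<delta> n > 0"
    and fill: "\<And>n (f :: complex \<Rightarrow> 'a). continuous_on (cball 0 1) f \<Longrightarrow> f ` cball 0 1 \<subseteq> X \<Longrightarrow>
      f ` sphere 0 1 \<subseteq> X \<inter> ball x0 (\<delta> n) \<Longrightarrow>
      \<exists>g. continuous_on (cball 0 1) g \<and> (\<forall>z\<in>sphere 0 1. g z = f z) \<and>
         g ` cball 0 1 \<subseteq> X \<inter> ball x0 (1 / (real n + 1))"
    by metis
  \<comment> \<open>A small homotopy will join a loop in \<open>U n\<close> to one in \<open>U (Suc n)\<close>, and both must lie in the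
    ball of radius \<open>\<delta> n\<close>; hence the decreasing intersections.\<close>
  define U where "U n = X \<inter> (\<Inter>k\<le>n. ball x0 (\<delta> k))" for n
  have "\<exists>p. loop_at (U n) x0 p \<and> homotopic_paths X p \<gamma>" for n
  proof (rule small)
    show "openin (top_of_set X) (U n)"
      unfolding U_def by (intro openin_open_Int open_INT) auto
  qed (use assms(1) \<delta> in \<open>auto simp: U_def\<close>)
  then obtain P' where P': "\<And>n. loop_at (U n) x0 (P' n)" "\<And>n. homotopic_paths X (P' n) \<gamma>"
    by metis
  define P where "P n = (case n of 0 \<Rightarrow> \<gamma> | Suc m \<Rightarrow> P' m)" for n
  \<comment> \<open>Index \<open>0\<close> is \<open>\<gamma>\<close> itself, which is not small; the homotopy that leaves it stays
    unchanged, and the smallness bounds below therefore start at index \<open>1\<close>.\<close>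
  have P_loop: "loop_at X x0 (P n)" for n
    using \<gamma> P'(1) by (cases n) (auto simp: P_def loop_at_def U_def)
  have P_hom: "homotopic_paths X (P n) (P (Suc n))" for n
  proof -
    have "homotopic_paths X (P n) \<gamma>" for n
      using \<gamma> P'(2) by (cases n) (auto simp: P_def loop_at_def)
    then show ?thesis by (meson homotopic_paths_sym homotopic_paths_trans)
  qed
  have "\<exists>k. continuous_on ?Q k \<and> k ` ?Q \<subseteq> X \<and>
      (\<forall>t\<in>{0..1}. k (0, t) = P n t \<and> k (1, t) = P (Suc n) t) \<and>
      (\<forall>s\<in>{0..1}. k (s, 0) = x0 \<and> k (s, 1) = x0) \<and>
      (\<forall>m. n = Suc m \<longrightarrow> k ` ?Q \<subseteq> ball x0 (1 / (real m + 1)))" for n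
  proof -
    obtain h where h: "continuous_on ?Q h" "h ` ?Q \<subseteq> X"
      "\<And>t. t \<in> {0..1} \<Longrightarrow> h (0, t) = P n t" "\<And>t. t \<in> {0..1} \<Longrightarrow> h (1, t) = P (Suc n) t"
      "\<And>s. s \<in> {0..1} \<Longrightarrow> h (s, 0) = x0 \<and> h (s, 1) = x0"
      using homotopic_loops_square[OF P_hom] P_loop unfolding loop_at_def by metis
    show ?thesis
    proof (cases n)
      case 0
      then show ?thesis using h by (intro exI[of _ h]) auto
    next
      case (Suc m)
      have ends: "P n t \<in> U m" "P (Suc n) t \<in> U (Suc m)" if "t \<in> {0..1}" for t
      proof -
        have "P' j t \<in> U j" for j
          using P'(1)[of j] that unfolding loop_at_def path_image_def by blast
        then show "P n t \<in> U m" "P (Suc n) t \<in> U (Suc m)"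
          by (auto simp: P_def Suc)
      qed
      have bd: "h ` (?Q - ?I) \<subseteq> X \<inter> ball x0 (\<delta> m)"
      proof (intro image_subsetI)
        fix z assume z: "z \<in> ?Q - ?I"
        then obtain s t where st: "z = (s, t)" "s \<in> {0..1}" "t \<in> {0..1}"
          "s = 0 \<or> s = 1 \<or> t = 0 \<or> t = 1" by fastforce
        then have "h z = P n t \<or> h z = P (Suc n) t \<or> h z = x0" using h by auto
        then show "h z \<in> X \<inter> ball x0 (\<delta> m)"
          using ends[OF st(3)] assms(1) \<delta>[of m] by (auto simp: U_def)
      qed
      obtain k where k: "continuous_on ?Q k" "k ` ?Q \<subseteq> X \<inter> ball x0 (1 / (real m + 1))"
        "\<And>z. z \<in> ?Q - ?I \<Longrightarrow> k z = h z"
        by (rule fill_square_from_fill_disc[OF _ h(1,2) bd,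
              of "X \<inter> ball x0 (1 / (real m + 1))"]) (use fill[of _ m] in blast)+
      show ?thesis
        using k h Suc by (intro exI[of _ k]) auto
    qed
  qed
  then obtain K where K: "\<And>n. continuous_on ?Q (K n)" "\<And>n. K n ` ?Q \<subseteq> X"
    "\<And>n t. t \<in> {0..1} \<Longrightarrow> K n (0, t) = P n t \<and> K n (1, t) = P (Suc n) t"
    "\<And>n s. s \<in> {0..1} \<Longrightarrow> K n (s, 0) = x0 \<and> K n (s, 1) = x0"
    "\<And>m. K (Suc m) ` ?Q \<subseteq> ball x0 (1 / (real m + 1))"
    by metis
  have "nulhomotopic_loop X \<gamma>"
  proof (rule nulhomotopic_loop_if_shrinking_homotopies[OF assms(1) K(1,2) _ K(4)])
    show "\<forall>\<^sub>F n in sequentially. K n ` ?Q \<subseteq> ball x0 e" if e: "e > 0" for e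
    proof -
      obtain N where N: "1 / (real N + 1) < e"
        using nat_approx_posE[OF e] by (auto simp: add.commute)
      have "K n ` ?Q \<subseteq> ball x0 e" if n: "n \<ge> Suc N" for n
      proof -
        obtain m where m: "n = Suc m" "m \<ge> N" using n by (cases n) auto
        then have "1 / (real m + 1) \<le> 1 / (real N + 1)" by (simp add: frac_le)
        then show ?thesis using K(5)[of m] N m(1) by (meson dual_order.trans less_imp_le subset_ball)
      qed
      then show ?thesis unfolding eventually_sequentially by blast
    qed
  qed (use K(3) in \<open>auto simp: P_def\<close>)
  with \<gamma> show False by blast
qed

end
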